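(* In the ring of formal power series in the variable $q$, $$\sum_{n=0}^\infty \frac{(-1;q^2)_n\, q^{n^2+n}}{(q^2;q^2)_n\,(-q;q^2)_n} = \prod_{n=1}^\infty \frac{(1-q^{6n-3})^2(1-q^{6n})}{(1-q^{4n-2})(1-q^{2n})}.$$
   Context: $q$ is a formal variable. For an integer $n\ge 0$, $(a;q)_n=(1-a)(1-aq)(1-aq^2)\cdots(1-aq^{n-1})$, with $(a;q)_0=1$. Replacing the base $q$ by $q^k$ gives $(a;q^k)_n=\prod_{j=0}^{n-1}(1-aq^{kj})$; thus $(-1;q^2)_n=\prod_{j=0}^{n-1}(1+q^{2j})$, $(q^2;q^2)_n=\prod_{j=1}^{n}(1-q^{2j})$ and $(-q;q^2)_n=\prod_{j=1}^{n}(1+q^{2j-1})$. Infinite sums and products are understood in the usual topology of formal power series, and reciprocals are those of power series with constant term $1$. *)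

theory Defs
  imports "HOL-Analysis.Analysis" "HOL-Computational_Algebra.Formal_Power_Series"
begin

text \<open>The base is an explicit argument, so \<open>(a; q\<^sup>k)\<^sub>n\<close> is \<open>q_poch a (q ^ k) n\<close>.\<close>

definition q_poch :: "'a::comm_ring_1 \<Rightarrow> 'a \<Rightarrow> nat \<Rightarrow> 'a" where
  "q_poch a q n = (\<Prod>j<n. 1 - a * q ^ j)"

end

theory Submission
  imports Defs
begin

text \<open>
  Put \<open>Q = q\<^sup>2\<close>. Bailey's lemma at \<open>a = 1\<close>, with one parameter sent to infinity and the other equal
  to \<open>-q\<close>, turns the unit Bailey pair into one with \<open>\<beta>\<^sub>n = 1 / ((Q; Q)\<^sub>n (-q; Q)\<^sub>n)\<close>; a second
  application with parameter \<open>-1\<close> expresses a finite form of the series through the theta sum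
  \<open>R = \<Sum> (-1)\<^sup>r q^(3 r\<^sup>2)\<close> over all integers \<open>r\<close>. The same application of the lemma to the unit pair
  in base \<open>q\<^sup>3\<close> evaluates \<open>R\<close> as a product. Everything is finite until the last step: the partial sums
  and the partial products of index \<open>N\<close> agree modulo \<open>q\<^sup>N\<close>, so they have the same limit.
\<close>

section \<open>Shifted factorials and their reciprocals\<close>

lemma q_poch_0 [simp]: "q_poch a q 0 = 1"
  by (simp add: q_poch_def)

lemma q_poch_Suc: "q_poch a q (Suc n) = q_poch a q n * (1 - a * q ^ n)"
  by (simp add: q_poch_def)

lemma q_poch_Suc_shift: "q_poch a q (Suc n) = (1 - a) * q_poch (a * q) q n"
  by (simp add: q_poch_def prod.lessThan_Suc_shift mult_ac del: prod.lessThan_Suc)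

lemma q_poch_add: "q_poch a q (m + n) = q_poch a q m * q_poch (a * q ^ m) q n"
  by (induction n) (simp_all add: q_poch_Suc power_add mult_ac)

lemma fps_nth_q_poch_0:
  assumes "fps_nth q 0 = 0"
  shows "fps_nth (q_poch (a * q) q n) 0 = 1"
  by (induction n) (simp_all add: q_poch_Suc assms)

definition q_fact_inv :: "'a::field fps \<Rightarrow> nat \<Rightarrow> 'a fps" where
  "q_fact_inv q n = inverse (q_poch q q n)"

context
  fixes q :: "'a::field fps"
  assumes q0: "fps_nth q 0 = 0"
begin

lemma q_fact_inv_0 [simp]: "q_fact_inv q 0 = 1"
  by (simp add: q_fact_inv_def)

lemma q_fact_inv_mult: "q_fact_inv q n * q_poch q q n = 1"
  unfolding q_fact_inv_def
  using fps_nth_q_poch_0[OF q0, of 1 n] by (intro inverse_mult_eq_1) simp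

lemma q_fact_inv_Suc: "q_fact_inv q n = (1 - q ^ Suc n) * q_fact_inv q (Suc n)"
proof -
  have "q_fact_inv q n = q_fact_inv q n * (q_fact_inv q (Suc n) * q_poch q q (Suc n))"
    by (simp add: q_fact_inv_mult)
  also have "\<dots> = (q_fact_inv q n * q_poch q q n) * ((1 - q ^ Suc n) * q_fact_inv q (Suc n))"
    by (simp add: q_poch_Suc mult_ac)
  finally show ?thesis
    by (simp add: q_fact_inv_mult)
qed

lemma q_fact_inv_split: "q_fact_inv q m = q_fact_inv q (m + k) * q_poch (q * q ^ m) q k"
proof -
  have "q_fact_inv q (m + k) * q_poch (q * q ^ m) q k =
      q_fact_inv q (m + k) * q_poch (q * q ^ m) q k * (q_fact_inv q m * q_poch q q m)"
    by (simp add: q_fact_inv_mult)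
  also have "\<dots> = q_fact_inv q m * (q_fact_inv q (m + k) * q_poch q q (m + k))"
    by (simp add: q_poch_add mult_ac)
  finally show ?thesis
    by (simp add: q_fact_inv_mult)
qed

lemma one_minus_power_cancel:
  assumes "n > 0" and "(1 - q ^ n) * f = (1 - q ^ n) * g"
  shows "f = g"
proof -
  have "fps_nth (1 - q ^ n) 0 = 1"
    using assms(1) q0 by simp
  then have "1 - q ^ n \<noteq> 0"
    by (metis fps_zero_nth zero_neq_one)
  with assms(2) show ?thesis by simp
qed

section \<open>The q-Chu-Vandermonde sum\<close>

text \<open>Splits \<open>1 - q^(m+1)\<close> as \<open>(1 - q^k) + q^k (1 - q^(m+1-k))\<close>;
  each summand removes the last factor from one of the two denominators. The weight \<open>f\<close>
  is arbitrary, so the rule can drive an induction on \<open>m\<close>.\<close>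

lemma q_Pascal_sum:
  "(1 - q ^ Suc m) * (\<Sum>k\<le>Suc m. q_fact_inv q k * q_fact_inv q (Suc m - k) * f k) =
   (\<Sum>k\<le>m. q_fact_inv q k * q_fact_inv q (m - k) * (f (Suc k) + q ^ k * f k))"
proof -
  let ?e = "q_fact_inv q"
  have "(1 - q ^ Suc m) * (\<Sum>k\<le>Suc m. ?e k * ?e (Suc m - k) * f k) =
      (\<Sum>k\<le>Suc m. (1 - q ^ k) * ?e k * ?e (Suc m - k) * f k) +
      (\<Sum>k\<le>Suc m. ?e k * ((1 - q ^ (Suc m - k)) * ?e (Suc m - k)) * (q ^ k * f k))"
    unfolding sum_distrib_left sum.distrib [symmetric]
  proof (rule sum.cong, goal_cases)
    case (2 k)
    then have "q ^ Suc m = q ^ k * q ^ (Suc m - k)"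
      by (simp flip: power_add)
    then show ?case by (simp add: algebra_simps)
  qed simp
  \<comment> \<open>The term \<open>k = 0\<close> vanishes because of \<open>1 - q^0\<close>, so the
    index shifts; in the other sum the top term \<open>k = Suc m\<close> vanishes likewise.\<close>
  also have "(\<Sum>k\<le>Suc m. (1 - q ^ k) * ?e k * ?e (Suc m - k) * f k) =
      (\<Sum>k\<le>m. ?e k * ?e (m - k) * f (Suc k))"
    by (subst sum.atMost_Suc_shift) (simp flip: q_fact_inv_Suc power_Suc)
  also have "(\<Sum>k\<le>Suc m. ?e k * ((1 - q ^ (Suc m - k)) * ?e (Suc m - k)) * (q ^ k * f k)) =
      (\<Sum>k\<le>m. ?e k * ?e (m - k) * (q ^ k * f k))"
    by (simp add: Suc_diff_le flip: q_fact_inv_Suc power_Suc)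
  finally show ?thesis
    by (simp only: sum.distrib distrib_left)
qed

text \<open>Denominator-free form of the terminating series 2phi1(q^-m, b; c; q, c q^m / b) with
  \<open>c = b * d\<close>; taking \<open>d\<close> instead of \<open>c\<close> as parameter avoids
  dividing by \<open>b\<close>. The induction needs arbitrary \<open>d\<close>, since each step
  replaces \<open>d\<close> by \<open>d * q\<close>.\<close>

lemma q_Chu_Vandermonde:
  "(\<Sum>k\<le>m. q_fact_inv q k * q_fact_inv q (m - k) *
      (q_poch b q k * q_poch (b * d * q ^ k) q (m - k) * (-d) ^ k * q ^ (k choose 2))) =
   q_fact_inv q m * q_poch d q m"
proof (induction m arbitrary: d)
  case 0
  then show ?case by (simp add: binomial_eq_0)
next
  case (Suc m)
  let ?e = "q_fact_inv q"
  define t where "t m d k =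
    q_poch b q k * q_poch (b * d * q ^ k) q (m - k) * (-d) ^ k * q ^ (k choose 2)" for m d k
  \<comment> \<open>Up to common factors this is
    \<open>(1 - b d q^k) - d (1 - b q^k) = 1 - d\<close>.\<close>
  have step: "t (Suc m) d (Suc k) + q ^ k * t (Suc m) d k = (1 - d) * t m (d * q) k"
    if "k \<le> m" for k
  proof -
    have ch: "q ^ (Suc k choose 2) = q ^ k * q ^ (k choose 2)"
      by (simp add: numeral_2_eq_2 flip: power_add)
    have p1: "q_poch (b * d * q ^ k) q (Suc m - k) =
        (1 - b * d * q ^ k) * q_poch (b * (d * q) * q ^ k) q (m - k)"
      using that by (simp add: Suc_diff_le q_poch_Suc_shift mult_ac)
    have p2: "(-(d * q)) ^ k = (-d) ^ k * q ^ k"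
      by (simp flip: power_mult_distrib)
    have p3: "b * d * q ^ Suc k = b * (d * q) * q ^ k"
      by (simp add: mult_ac)
    show ?thesis
      unfolding t_def ch p1 p2 p3 diff_Suc_Suc by (simp add: q_poch_Suc algebra_simps)
  qed
  have "(1 - q ^ Suc m) * (\<Sum>k\<le>Suc m. ?e k * ?e (Suc m - k) * t (Suc m) d k) =
      (1 - d) * (\<Sum>k\<le>m. ?e k * ?e (m - k) * t m (d * q) k)"
    unfolding q_Pascal_sum unfolding sum_distrib_left
    by (intro sum.cong) (simp_all add: step mult_ac)
  also have "\<dots> = (1 - d) * (?e m * q_poch (d * q) q m)"
    unfolding t_def Suc.IH ..
  also have "\<dots> = (1 - q ^ Suc m) * (?e (Suc m) * q_poch d q (Suc m))"
    by (simp add: q_poch_Suc_shift q_fact_inv_Suc[of m] mult_ac)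
  finally show ?case
    unfolding t_def by (rule one_minus_power_cancel[rotated]) simp
qed

section \<open>Bailey's lemma at a = 1 and the unit Bailey pair\<close>

text \<open>With \<open>n = k + r\<close> this is q-Chu-Vandermonde for
  \<open>b = \<rho> q^r\<close> and \<open>d = \<sigma> q^r\<close>. As
  \<open>\<rho> * \<sigma> = q\<close>, the lower parameter is \<open>q^(2r+1)\<close>, and its
  factors are exactly those that extend \<open>(q; q)_(n+r)\<close> to
  \<open>(q; q)_(N+r)\<close>.\<close>

lemma Bailey_kernel:
  assumes "r \<le> N" and \<rho>\<sigma>: "\<rho> * \<sigma> = q"
  shows "(\<Sum>n=r..N. q_poch \<rho> q n * (-\<sigma>) ^ n * q ^ (n choose 2) * q_fact_inv q (N - n) *
            (q_fact_inv q (n - r) * q_fact_inv q (n + r))) =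
         q_poch (\<sigma> * q ^ r) q (N - r) * q_poch \<rho> q r * (-\<sigma>) ^ r * q ^ (r choose 2) *
            (q_fact_inv q (N - r) * q_fact_inv q (N + r))"
proof -
  let ?e = "q_fact_inv q"
  let ?c = "q_poch \<rho> q r * (-\<sigma>) ^ r * q ^ (r choose 2)"
  define M where "M = N - r"
  have N: "N = M + r"
    using assms(1) by (simp add: M_def)
  have term_eq: "q_poch \<rho> q (k + r) * (-\<sigma>) ^ (k + r) * q ^ (k + r choose 2) * ?e (M - k) *
        (?e k * ?e (k + r + r)) =
      ?c * ?e (N + r) * (?e k * ?e (M - k) * (q_poch (\<rho> * q ^ r) q k *
        q_poch (\<rho> * q ^ r * (\<sigma> * q ^ r) * q ^ k) q (M - k) *
        (-(\<sigma> * q ^ r)) ^ k * q ^ (k choose 2)))"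
    if "k \<le> M" for k
  proof -
    have "(k + r choose 2) = (k choose 2) + (r choose 2) + r * k"
      by (induction k) (simp_all add: numeral_2_eq_2)
    then have ch: "q ^ (k + r choose 2) = q ^ (k choose 2) * q ^ (r choose 2) * q ^ (r * k)"
      by (simp add: power_add)
    have e: "?e (k + r + r) = ?e (N + r) * q_poch (q * q ^ (k + r + r)) q (M - k)"
      using that N q_fact_inv_split[of "k + r + r" "M - k"] by (simp add: add_ac)
    have p1: "\<rho> * q ^ r * (\<sigma> * q ^ r) * q ^ k = q * q ^ (k + r + r)"
      unfolding \<rho>\<sigma>[symmetric, THEN arg_cong, of "\<lambda>x. x * q ^ (k + r + r)"]
      by (simp only: power_add mult_ac)
    have p2: "(-(\<sigma> * q ^ r)) ^ k = (-\<sigma>) ^ k * q ^ (r * k)"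
      by (simp add: power_mult flip: power_mult_distrib)
    have p3: "q_poch \<rho> q (k + r) = q_poch \<rho> q r * q_poch (\<rho> * q ^ r) q k"
      by (simp add: add.commute[of k] q_poch_add)
    show ?thesis
      unfolding e p1 p2 p3 ch by (simp only: power_add[of "-\<sigma>"] mult_ac)
  qed
  have "(\<Sum>n=r..N. q_poch \<rho> q n * (-\<sigma>) ^ n * q ^ (n choose 2) * ?e (N - n) *
            (?e (n - r) * ?e (n + r))) =
        (\<Sum>k\<le>M. q_poch \<rho> q (k + r) * (-\<sigma>) ^ (k + r) * q ^ (k + r choose 2) *
            ?e (M - k) * (?e k * ?e (k + r + r)))"
    by (rule sum.reindex_bij_witness[of _ "\<lambda>k. k + r" "\<lambda>n. n - r"]) (auto simp: N)
  also have "\<dots> = ?c * ?e (N + r) * (?e M * q_poch (\<sigma> * q ^ r) q M)"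
    unfolding q_Chu_Vandermonde[symmetric, where b = "\<rho> * q ^ r"] sum_distrib_left
    by (intro sum.cong refl term_eq) simp
  finally show ?thesis
    by (simp add: M_def mult_ac)
qed

text \<open>Inserting the relation between \<open>\<alpha>\<close> and \<open>\<beta>\<close> and
  interchanging the triangular double sum leaves \<open>Bailey_kernel\<close> as inner sum. The
  second parameter of Bailey's lemma has gone to infinity, which produces the factor
  \<open>(-\<sigma>)^n q^(n choose 2)\<close>.\<close>

lemma Bailey_lemma:
  assumes "\<rho> * \<sigma> = q"
  assumes "\<And>n. \<beta> n = (\<Sum>r\<le>n. \<alpha> r * (q_fact_inv q (n - r) * q_fact_inv q (n + r)))"
  shows "(\<Sum>n\<le>N. q_poch \<rho> q n * (-\<sigma>) ^ n * q ^ (n choose 2) * q_fact_inv q (N - n) * \<beta> n) =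
         (\<Sum>r\<le>N. q_poch (\<sigma> * q ^ r) q (N - r) * q_poch \<rho> q r * (-\<sigma>) ^ r * q ^ (r choose 2) * \<alpha> r *
            (q_fact_inv q (N - r) * q_fact_inv q (N + r)))"
proof -
  let ?e = "q_fact_inv q"
  let ?c = "\<lambda>n. q_poch \<rho> q n * (-\<sigma>) ^ n * q ^ (n choose 2) * ?e (N - n)"
  have "(\<Sum>n\<le>N. ?c n * \<beta> n) =
      (\<Sum>n\<le>N. \<Sum>r\<le>n. ?c n * (\<alpha> r * (?e (n - r) * ?e (n + r))))"
    by (simp add: assms(2) sum_distrib_left)
  also have "\<dots> = (\<Sum>r\<le>N. \<Sum>n=r..N. ?c n * (\<alpha> r * (?e (n - r) * ?e (n + r))))"
    unfolding sum.Sigma[OF finite_atMost ballI[OF finite_atMost]]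
      sum.Sigma[OF finite_atMost ballI[OF finite_atLeastAtMost]]
    by (rule sum.reindex_bij_witness[of _ "\<lambda>(r, n). (n, r)" "\<lambda>(n, r). (r, n)"]) auto
  also have "\<dots> = (\<Sum>r\<le>N. \<alpha> r * (\<Sum>n=r..N. ?c n * (?e (n - r) * ?e (n + r))))"
    by (simp add: sum_distrib_left mult_ac)
  also have "\<dots> = (\<Sum>r\<le>N. \<alpha> r * (q_poch (\<sigma> * q ^ r) q (N - r) * q_poch \<rho> q r *
      (-\<sigma>) ^ r * q ^ (r choose 2) * (?e (N - r) * ?e (N + r))))"
    by (intro sum.cong refl) (simp add: Bailey_kernel[OF _ assms(1)])
  finally show ?thesis
    by (simp add: mult_ac)
qed

text \<open>
  The \<open>\<alpha>\<close>-part of the unit Bailey pair at \<open>a = 1\<close>. The terms of index \<open>r\<close> and \<open>-r\<close> of a bilateral sum are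
  merged, so \<open>r = 0\<close> has to be treated separately.
\<close>

definition unit_Bailey :: "nat \<Rightarrow> 'a fps" where
  "unit_Bailey r = (-1) ^ r * q ^ (r choose 2) * (if r = 0 then 1 else 1 + q ^ r)"

text \<open>A telescoping sum: the closed form for every \<open>m\<close> makes the induction
  possible, and at \<open>m = n\<close> it vanishes through the factor
  \<open>1 - q^(n-m)\<close>.\<close>

lemma unit_Bailey_partial_sum:
  assumes "m \<le> n" "n > 0"
  shows "(1 - q ^ n) * (\<Sum>r\<le>m. unit_Bailey r * (q_fact_inv q (n - r) * q_fact_inv q (n + r))) =
         (-1) ^ m * q ^ (Suc m choose 2) * (1 - q ^ (n - m)) *
           (q_fact_inv q (n - m) * q_fact_inv q (n + m))"
  using assms(1)
proof (induction m)
  case 0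
  then show ?case by (simp add: unit_Bailey_def numeral_2_eq_2)
next
  case (Suc m)
  let ?e = "q_fact_inv q"
  define k where "k = n - Suc m"
  have n: "n = k + Suc m"
    using Suc.prems by (simp add: k_def)
  \<comment> \<open>The previous partial sum is brought to the denominators \<open>(q; q)_k\<close>
    and \<open>(q; q)_(n+m+1)\<close> of the new term.\<close>
  have e1: "?e (n - m) * (1 - q ^ (n - m)) = ?e k"
    using q_fact_inv_Suc[of k] by (simp add: n mult_ac)
  have e2: "?e (n + m) = (1 - q ^ (n + Suc m)) * ?e (n + Suc m)"
    using q_fact_inv_Suc[of "n + m"] by simp
  have "(-1) ^ m * q ^ (Suc m choose 2) * (1 - q ^ (n - m)) * (?e (n - m) * ?e (n + m)) =
      (-1) ^ m * q ^ (Suc m choose 2) * (?e (n - m) * (1 - q ^ (n - m))) * ?e (n + m)"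
    by (simp add: mult_ac)
  also have "\<dots> = (-1) ^ m * q ^ (Suc m choose 2) * ?e k * (1 - q ^ (n + Suc m)) * ?e (n + Suc m)"
    unfolding e1 e2 by (simp add: mult_ac)
  finally have IH: "(1 - q ^ n) * (\<Sum>r\<le>m. unit_Bailey r * (?e (n - r) * ?e (n + r))) = \<dots>"
    using Suc by simp
  have "q ^ n = q ^ k * q ^ Suc m" "q ^ (n + Suc m) = q ^ k * q ^ Suc m * q ^ Suc m"
    by (simp_all add: n power_add mult_ac)
  moreover have "q ^ (Suc (Suc m) choose 2) = q ^ (Suc m choose 2) * q ^ Suc m"
    by (simp add: numeral_2_eq_2 power_add mult_ac)
  ultimately show ?case
    unfolding sum.atMost_Suc distrib_left IH
    by (simp add: unit_Bailey_def k_def[symmetric] del: power_Suc)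
       (simp add: algebra_simps del: power_Suc, simp)
qed

lemma unit_Bailey_pair:
  "(\<Sum>r\<le>n. unit_Bailey r * (q_fact_inv q (n - r) * q_fact_inv q (n + r))) = (if n = 0 then 1 else 0)"
proof (cases "n = 0")
  case False
  then have n: "n > 0" by simp
  have "(\<Sum>r\<le>n. unit_Bailey r * (q_fact_inv q (n - r) * q_fact_inv q (n + r))) = 0"
    by (rule one_minus_power_cancel[OF n], subst unit_Bailey_partial_sum[OF order_refl n]) simp
  with False show ?thesis by simp
qed (simp add: unit_Bailey_def binomial_eq_0)

text \<open>For the unit pair only \<open>n = 0\<close> survives on the \<open>\<beta>\<close> side
  of Bailey's lemma.\<close>

lemma Bailey_lemma_unit:
  assumes "\<rho> * \<sigma> = q"
  shows "(\<Sum>r\<le>N. q_poch (\<sigma> * q ^ r) q (N - r) * q_poch \<rho> q r * (-\<sigma>) ^ r * q ^ (r choose 2) *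
            unit_Bailey r * (q_fact_inv q (N - r) * q_fact_inv q (N + r))) = q_fact_inv q N"
proof -
  have "(\<Sum>n\<le>N. q_poch \<rho> q n * (-\<sigma>) ^ n * q ^ (n choose 2) * q_fact_inv q (N - n) *
      (if n = 0 then 1 else 0)) = q_fact_inv q N"
    by (simp add: if_distrib[where f = "\<lambda>x. _ * x"] sum.delta binomial_eq_0 cong: if_cong)
  then show ?thesis
    using Bailey_lemma[OF assms unit_Bailey_pair[symmetric]] by simp
qed

section \<open>Bailey's lemma with parameter -1 and a finite form of Gauss's theta sum\<close>

text \<open>For \<open>r > 0\<close>, \<open>(-1; q)_r (1 + q^r) = 2 (-q; q)_r\<close>, which the
  remaining factors complete to \<open>(-q; q)_N\<close>. The 2 reflects the merged indices
  \<open>r\<close> and \<open>-r\<close>.\<close>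

lemma q_poch_neg_one_weight:
  assumes "r \<le> N"
  shows "q_poch (-q * q ^ r) q (N - r) * q_poch (-1) q r * (if r = 0 then 1 else 1 + q ^ r) =
    (if r = 0 then 1 else 2) * q_poch (-q) q N"
proof (cases r)
  case (Suc m)
  have "q_poch (-1) q r * (1 + q ^ r) = 2 * q_poch (-q) q r"
    by (simp add: Suc q_poch_Suc_shift[of "-1"] q_poch_Suc[of "-q"] mult_ac)
  moreover have "q_poch (-q) q N = q_poch (-q) q r * q_poch (-q * q ^ r) q (N - r)"
    using assms q_poch_add[of "-q" q r "N - r"] by simp
  ultimately show ?thesis
    using Suc by (simp add: mult_ac)
qed simp

text \<open>The case \<open>\<rho> = -1\<close>, \<open>\<sigma> = -q\<close>. The factor
  \<open>1 + q^r\<close> is kept apart from \<open>\<alpha>\<close> so that the weight collapses to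
  a product free of \<open>r\<close>, which leaves the sum.\<close>

lemma Bailey_lemma_neg_one:
  assumes "\<And>n. \<beta> n = (\<Sum>r\<le>n. \<alpha> r * (if r = 0 then 1 else 1 + q ^ r) *
             (q_fact_inv q (n - r) * q_fact_inv q (n + r)))"
  shows "(\<Sum>n\<le>N. q_poch (-1) q n * q ^ (Suc n choose 2) * q_fact_inv q (N - n) * \<beta> n) =
         q_poch (-q) q N * (\<Sum>r\<le>N. (if r = 0 then 1 else 2) * q ^ (Suc r choose 2) * \<alpha> r *
            (q_fact_inv q (N - r) * q_fact_inv q (N + r)))"
proof -
  let ?e = "q_fact_inv q" and ?w = "\<lambda>r. if r = 0 then 1 else 1 + q ^ r"
  have pw: "(- (-q)) ^ n * q ^ (n choose 2) = q ^ (Suc n choose 2)" for n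
    by (simp add: numeral_2_eq_2 flip: power_add)
  have "(\<Sum>n\<le>N. q_poch (-1) q n * q ^ (Suc n choose 2) * ?e (N - n) * \<beta> n) =
      (\<Sum>r\<le>N. q_poch (-q * q ^ r) q (N - r) * q_poch (-1) q r * (- (-q)) ^ r * q ^ (r choose 2) *
        (\<alpha> r * ?w r) * (?e (N - r) * ?e (N + r)))"
    using Bailey_lemma[of "-1" "-q" \<beta> "\<lambda>r. \<alpha> r * ?w r" N, OF _ assms]
    by (simp only: mult.assoc pw) (simp add: mult.assoc)
  also have "\<dots> = (\<Sum>r\<le>N. (q_poch (-q * q ^ r) q (N - r) * q_poch (-1) q r * ?w r) *
      ((- (-q)) ^ r * q ^ (r choose 2)) * \<alpha> r * (?e (N - r) * ?e (N + r)))"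
    by (simp only: mult_ac)
  also have "\<dots> = (\<Sum>r\<le>N. ((if r = 0 then 1 else 2) * q_poch (-q) q N) *
      q ^ (Suc r choose 2) * \<alpha> r * (?e (N - r) * ?e (N + r)))"
    unfolding pw by (intro sum.cong refl arg_cong2[where f = "(*)"] q_poch_neg_one_weight) simp
  finally show ?thesis
    by (simp only: sum_distrib_left mult_ac)
qed

text \<open>The unit pair yields the exponent \<open>(Suc r choose 2) + (r choose 2) = r^2\<close>.
  For \<open>N\<close> tending to infinity this becomes Gauss's evaluation of the bilateral sum of
  \<open>(-1)^r q^(r^2)\<close> as \<open>(q; q) / (-q; q)\<close> with infinite products.\<close>

lemma finite_Gauss_sum:
  "q_fact_inv q N = q_poch (-q) q N * (\<Sum>r\<le>N. (if r = 0 then 1 else 2) * (-1) ^ r * q ^ (r ^ 2) *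
      (q_fact_inv q (N - r) * q_fact_inv q (N + r)))"
proof -
  have sq: "(Suc r choose 2) + (r choose 2) = r ^ 2" for r
    by (induction r) (simp_all add: numeral_2_eq_2)
  have "q_fact_inv q N = (\<Sum>n\<le>N. q_poch (-1) q n * q ^ (Suc n choose 2) * q_fact_inv q (N - n) *
      (if n = 0 then 1 else 0))"
    by (simp add: if_distrib[where f = "\<lambda>x. _ * x"] binomial_eq_0 cong: if_cong)
  also have "\<dots> = q_poch (-q) q N * (\<Sum>r\<le>N. (if r = 0 then 1 else 2) * q ^ (Suc r choose 2) *
      ((-1) ^ r * q ^ (r choose 2)) * (q_fact_inv q (N - r) * q_fact_inv q (N + r)))"
    by (rule Bailey_lemma_neg_one) (simp flip: unit_Bailey_pair unit_Bailey_def)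
  also have "(\<lambda>r. (if r = 0 then 1 else 2) * q ^ (Suc r choose 2) * ((-1) ^ r * q ^ (r choose 2))) =
      (\<lambda>r. (if r = 0 then 1 else 2) * (-1) ^ r * q ^ (r ^ 2))"
    by (simp only: sq[symmetric] power_add mult_ac)
  finally show ?thesis .
qed

section \<open>Congruences modulo powers of \<open>fps_X\<close>\<close>

lemma fps_X_power_dvd_power: "fps_X ^ n dvd q ^ n"
proof -
  have "q = fps_X * fps_shift 1 q"
    by (rule fps_ext) (simp add: q0)
  then have "fps_X dvd q" by (metis dvd_triv_left)
  then show ?thesis by (rule dvd_power_same)
qed

lemma q_poch_tail_dvd: "fps_X ^ n dvd q_poch (a * q ^ n) q k - 1"
proof (induction k)
  case (Suc k)
  have "q_poch (a * q ^ n) q (Suc k) - 1 =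
      (q_poch (a * q ^ n) q k - 1) - q ^ n * (q_poch (a * q ^ n) q k * a * q ^ k)"
    by (simp add: q_poch_Suc algebra_simps)
  then show ?case
    using Suc fps_X_power_dvd_power[of n] by (metis dvd_diff dvd_mult2)
qed simp

lemma q_fact_inv_diff_dvd:
  assumes "n \<le> m" "n \<le> m'"
  shows "fps_X ^ n dvd q_fact_inv q m - q_fact_inv q m'"
proof -
  have *: "fps_X ^ n dvd q_fact_inv q n - q_fact_inv q m" if nm: "n \<le> m" for m
  proof -
    have "q_fact_inv q n - q_fact_inv q m = q_fact_inv q m * (q_poch (q * q ^ n) q (m - n) - 1)"
      using q_fact_inv_split[of n "m - n"] nm by (simp add: algebra_simps)
    then show ?thesis
      by (simp add: q_poch_tail_dvd)
  qed
  have "fps_X ^ n dvd (q_fact_inv q n - q_fact_inv q m') - (q_fact_inv q n - q_fact_inv q m)"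
    by (intro dvd_diff * assms)
  then show ?thesis by simp
qed

text \<open>Both reciprocals agree with \<open>q_fact_inv q N\<close> modulo
  \<open>fps_X ^ (N - r)\<close>, and \<open>f r\<close> supplies the missing factor
  \<open>fps_X ^ r\<close>.\<close>

lemma theta_sum_mod:
  assumes "\<And>r. fps_X ^ r dvd f r"
  shows "(\<Sum>r\<le>N. f r * (q_fact_inv q (N - r) * q_fact_inv q (N + r))) mod fps_X ^ N =
    (q_fact_inv q N ^ 2 * (\<Sum>r\<le>N. f r)) mod fps_X ^ N"
  unfolding mod_eq_dvd_iff sum_distrib_left sum_subtractf [symmetric]
proof (rule dvd_sum)
  fix r assume "r \<in> {..N}"
  then have N: "fps_X ^ N = (fps_X :: 'a fps) ^ r * fps_X ^ (N - r)"
    by (simp flip: power_add)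
  let ?e = "q_fact_inv q"
  have "f r * (?e (N - r) * ?e (N + r)) - ?e N ^ 2 * f r =
      f r * (?e (N + r) * (?e (N - r) - ?e N) + ?e N * (?e (N + r) - ?e N))"
    by (simp add: algebra_simps power2_eq_square)
  moreover have "fps_X ^ (N - r) dvd ?e (N + r) * (?e (N - r) - ?e N) + ?e N * (?e (N + r) - ?e N)"
    by (intro dvd_add dvd_mult q_fact_inv_diff_dvd) auto
  ultimately show "fps_X ^ N dvd f r * (?e (N - r) * ?e (N + r)) - ?e N ^ 2 * f r"
    unfolding N using assms[of r] by (simp add: mult_dvd_mono)
qed

lemma convolution_sum_mod:
  assumes "\<And>n. fps_X ^ n dvd f n"
  shows "(\<Sum>n\<le>N. f n * q_fact_inv q (N - n)) mod fps_X ^ N =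
    (q_fact_inv q N * (\<Sum>n\<le>N. f n)) mod fps_X ^ N"
  unfolding mod_eq_dvd_iff sum_distrib_left sum_subtractf [symmetric]
proof (rule dvd_sum)
  fix n assume "n \<in> {..N}"
  then have N: "fps_X ^ N = (fps_X :: 'a fps) ^ n * fps_X ^ (N - n)"
    by (simp flip: power_add)
  have "f n * q_fact_inv q (N - n) - q_fact_inv q N * f n =
      f n * (q_fact_inv q (N - n) - q_fact_inv q N)"
    by (simp add: algebra_simps)
  then show "fps_X ^ N dvd f n * q_fact_inv q (N - n) - q_fact_inv q N * f n"
    unfolding N using assms[of n] by (simp add: mult_dvd_mono q_fact_inv_diff_dvd)
qed

lemma q_poch_double: "q_poch q q (2 * N) = q_poch q (q ^ 2) N * q_poch (q ^ 2) (q ^ 2) N"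
proof (induction N)
  case (Suc N)
  have "q * q ^ (2 * N) = q * (q ^ 2) ^ N" "q * q ^ Suc (2 * N) = q ^ 2 * (q ^ 2) ^ N"
    by (simp_all only: power_mult power_Suc power2_eq_square power_mult_distrib mult_ac)
  then show ?case
    using Suc by (simp add: q_poch_Suc mult_ac del: power_Suc)
qed simp

lemma q_poch_square: "q_poch (q ^ 2) (q ^ 2) N = q_poch q q N * q_poch (-q) q N"
proof (induction N)
  case (Suc N)
  have "1 - q ^ 2 * (q ^ 2) ^ N = (1 - q * q ^ N) * (1 - (-q) * q ^ N)"
    by (simp add: algebra_simps power2_eq_square power_mult_distrib)
  then show ?case
    using Suc by (simp only: q_poch_Suc mult_ac)
qed simp

lemma q_poch_double_mod: "q_poch q q (2 * N) mod fps_X ^ N = q_poch q q N mod fps_X ^ N"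
proof -
  have "q_poch q q (2 * N) - q_poch q q N = q_poch q q N * (q_poch (q * q ^ N) q N - 1)"
    unfolding mult_2 q_poch_add by (simp add: right_diff_distrib)
  then show ?thesis
    by (simp add: mod_eq_dvd_iff q_poch_tail_dvd)
qed

text \<open>Finite version of Euler's theorem on odd and distinct parts: \<open>(q; q)_(2N)\<close>
  equals \<open>(q; q^2)_N (q; q)_N (-q; q)_N\<close> and is congruent to
  \<open>(q; q)_N\<close>.\<close>

lemma Euler_odd_distinct_mod:
  "(q_poch q (q ^ 2) N * q_poch (-q) q N) mod fps_X ^ N = 1 mod fps_X ^ N"
proof -
  have "q_poch q (q ^ 2) N * q_poch (-q) q N =
      q_fact_inv q N * q_poch q q N * (q_poch q (q ^ 2) N * q_poch (-q) q N)"
    by (simp add: q_fact_inv_mult)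
  also have "\<dots> = q_fact_inv q N * q_poch q q (2 * N)"
    unfolding q_poch_double q_poch_square by (simp only: mult_ac)
  also have "\<dots> mod fps_X ^ N = (q_fact_inv q N * q_poch q q N) mod fps_X ^ N"
    by (intro mod_mult_cong refl q_poch_double_mod)
  finally show ?thesis
    by (simp add: q_fact_inv_mult)
qed

lemma Gauss_sum_mod:
  "(\<Sum>r\<le>N. (if r = 0 then 1 else 2) * (-1) ^ r * q ^ (r ^ 2)) mod fps_X ^ N =
   (q_poch q (q ^ 2) N ^ 2 * q_poch (q ^ 2) (q ^ 2) N) mod fps_X ^ N" (is "?R mod _ = _")
proof -
  let ?e = "q_fact_inv q N" and ?P = "q_poch q q N"
  let ?o = "q_poch q (q ^ 2) N" and ?m = "q_poch (-q) q N"
  have dvd: "fps_X ^ r dvd (if r = 0 then 1 else 2) * (-1) ^ r * q ^ (r ^ 2)" for r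
  proof -
    have "q ^ r dvd q ^ (r ^ 2)"
      by (intro le_imp_power_dvd) (simp add: power2_eq_square)
    then show ?thesis
      using fps_X_power_dvd_power[of r] by (intro dvd_mult) (rule dvd_trans)
  qed
  have "?e mod fps_X ^ N = (?m * (?e ^ 2 * ?R)) mod fps_X ^ N"
    by (subst finite_Gauss_sum) (intro mod_mult_cong refl theta_sum_mod dvd)
  \<comment> \<open>The factor \<open>?P ^ 2\<close> clears the reciprocals, while \<open>?o\<close>
    is there to cancel \<open>?m\<close> by Euler's theorem.\<close>
  then have "(?o * ?P ^ 2 * ?e) mod fps_X ^ N = (?o * ?P ^ 2 * (?m * (?e ^ 2 * ?R))) mod fps_X ^ N"
    by (intro mod_mult_cong refl)
  also have "?o * ?P ^ 2 * (?m * (?e ^ 2 * ?R)) = (?o * ?m) * ((?e * ?P) ^ 2 * ?R)"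
    by (simp only: power_mult_distrib mult_ac)
  also have "?o * ?P ^ 2 * ?e = ?o * ((?e * ?P) * ?P)"
    by (simp only: power2_eq_square mult_ac)
  finally have "(?o * ?P) mod fps_X ^ N = (?o * ?m * ?R) mod fps_X ^ N"
    by (simp add: q_fact_inv_mult)
  also have "\<dots> = (1 * ?R) mod fps_X ^ N"
    by (intro mod_mult_cong refl Euler_odd_distinct_mod)
  finally have "?R mod fps_X ^ N = (?o * ?P) mod fps_X ^ N" by simp
  \<comment> \<open>Passing to length \<open>2 * N\<close> lets \<open>(q; q)\<close> split into its
    odd and even factors, giving the second \<open>?o\<close>.\<close>
  also have "\<dots> = (?o * q_poch q q (2 * N)) mod fps_X ^ N"
    by (intro mod_mult_cong refl q_poch_double_mod [symmetric])
  finally show ?thesis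
    unfolding q_poch_double by (simp only: power2_eq_square mult_ac)
qed

end

section \<open>From congruences to limits\<close>

lemma fps_X_power_dvd_iff: "fps_X ^ N dvd f \<longleftrightarrow> (\<forall>k<N. fps_nth f k = 0)" for f :: "'a::field fps"
proof
  assume "\<forall>k<N. fps_nth f k = 0"
  then have "f = fps_X ^ N * fps_shift N f"
    by (intro fps_ext) (simp add: fps_X_power_mult_nth)
  then show "fps_X ^ N dvd f" by (metis dvd_triv_left)
qed (auto simp: fps_X_power_mult_nth elim!: dvdE)

text \<open>A congruence modulo \<open>fps_X ^ N\<close> fixes the coefficients below
  \<open>N\<close>, so coefficient \<open>k\<close> is constant from index \<open>Suc k\<close> on;
  hence the diagonal choice of \<open>L\<close>.\<close>

lemma fps_common_limit:
  fixes f g :: "nat \<Rightarrow> 'a::field fps"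
  assumes step: "\<And>N. fps_X ^ N dvd f (Suc N) - f N"
    and close: "\<And>N. fps_X ^ N dvd f N - g N"
  defines "L \<equiv> Abs_fps (\<lambda>k. fps_nth (f (Suc k)) k)"
  shows "f \<longlonglongrightarrow> L" and "g \<longlonglongrightarrow> L"
proof -
  have f: "fps_nth (f n) k = fps_nth L k" if "Suc k \<le> n" for n k
    using that
  proof (induction n rule: dec_induct)
    case (step n)
    then have "fps_nth (f (Suc n)) k = fps_nth (f n) k"
      using assms(1)[of n] by (simp add: fps_X_power_dvd_iff)
    with step show ?case by simp
  qed (simp add: L_def)
  have g: "fps_nth (g n) k = fps_nth L k" if "Suc k \<le> n" for n k
    using that f[of k n] close[of n] by (simp add: fps_X_power_dvd_iff)
  show "f \<longlonglongrightarrow> L"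
    by (rule tendsto_fpsI) (use f in \<open>auto simp: eventually_sequentially\<close>)
  show "g \<longlonglongrightarrow> L"
    by (rule tendsto_fpsI) (use g in \<open>auto simp: eventually_sequentially\<close>)
qed

section \<open>The modulo 6 identity\<close>

definition mod6_summand :: "nat \<Rightarrow> 'a::field fps" where
  "mod6_summand n = q_poch (-1) (fps_X ^ 2) n * fps_X ^ (n ^ 2 + n) *
     inverse (q_poch (fps_X ^ 2) (fps_X ^ 2) n * q_poch (-fps_X) (fps_X ^ 2) n)"

lemma mod6_summand_dvd: "fps_X ^ n dvd mod6_summand n"
  unfolding mod6_summand_def by (simp add: power_add)

text \<open>Since \<open>(-fps_X)^2 = q\<close>, both parameters can be \<open>-fps_X\<close>; their
  factors then join into \<open>(-fps_X; q)_n\<close>, which is free of \<open>r\<close> and can be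
  divided out. The factor \<open>1 + q^r\<close> stays separate, as
  \<open>Bailey_lemma_neg_one\<close> requires.\<close>

lemma Bailey_pair_square:
  fixes n :: nat
  defines "q \<equiv> fps_X ^ 2 :: 'a::field fps"
  shows "q_fact_inv q n * inverse (q_poch (-fps_X) q n) =
    (\<Sum>r\<le>n. (-1) ^ r * fps_X ^ (r ^ 2) * q ^ (r choose 2) * (if r = 0 then 1 else 1 + q ^ r) *
      (q_fact_inv q (n - r) * q_fact_inv q (n + r)))"
proof -
  have q0: "fps_nth q 0 = 0" by (simp add: q_def)
  let ?p = "q_poch (-fps_X) q"
  have "fps_nth (?p n) 0 \<noteq> 0"
    by (induction n) (simp_all add: q_poch_Suc)
  then have inv: "inverse (?p n) * ?p n = 1"
    by (rule inverse_mult_eq_1)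
  have pw: "(- (-fps_X)) ^ r * q ^ (r choose 2) = fps_X ^ (r ^ 2)" for r
  proof -
    have "r + 2 * (r choose 2) = r ^ 2"
      by (induction r) (simp_all add: numeral_2_eq_2)
    then show ?thesis by (simp add: q_def flip: power_mult power_add)
  qed
  have "q_fact_inv q n = (\<Sum>r\<le>n. (q_poch (-fps_X * q ^ r) q (n - r) * ?p r) *
      ((- (-fps_X)) ^ r * q ^ (r choose 2)) *
      unit_Bailey q r * (q_fact_inv q (n - r) * q_fact_inv q (n + r)))"
    by (subst Bailey_lemma_unit[OF q0, of "-fps_X" "-fps_X" n, symmetric])
       (simp_all only: q_def power2_eq_square minus_mult_minus mult_ac)
  also have "\<dots> = (\<Sum>r\<le>n. ?p n * fps_X ^ (r ^ 2) * unit_Bailey q r *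
      (q_fact_inv q (n - r) * q_fact_inv q (n + r)))"
  proof (rule sum.cong)
    fix r assume "r \<in> {..n}"
    then have "q_poch (-fps_X * q ^ r) q (n - r) * ?p r = ?p n"
      using q_poch_add[of "-fps_X" q r "n - r"] by (simp add: mult.commute)
    then show "(q_poch (-fps_X * q ^ r) q (n - r) * ?p r) *
        ((- (-fps_X)) ^ r * q ^ (r choose 2)) *
        unit_Bailey q r * (q_fact_inv q (n - r) * q_fact_inv q (n + r)) =
      ?p n * fps_X ^ (r ^ 2) * unit_Bailey q r * (q_fact_inv q (n - r) * q_fact_inv q (n + r))"
      unfolding pw by simp
  qed simp
  also have "\<dots> = ?p n * (\<Sum>r\<le>n. fps_X ^ (r ^ 2) * unit_Bailey q r *
      (q_fact_inv q (n - r) * q_fact_inv q (n + r)))"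
    by (simp add: sum_distrib_left mult_ac)
  finally have "q_fact_inv q n * inverse (?p n) = (inverse (?p n) * ?p n) *
      (\<Sum>r\<le>n. fps_X ^ (r ^ 2) * unit_Bailey q r * (q_fact_inv q (n - r) * q_fact_inv q (n + r)))"
    by (simp only: mult_ac)
  then show ?thesis
    unfolding inv by (simp only: unit_Bailey_def[OF q0] mult_ac mult_1)
qed

lemma finite_mod6_identity:
  fixes N :: nat
  defines "q \<equiv> fps_X ^ 2 :: 'a::field fps"
  shows "(\<Sum>n\<le>N. mod6_summand n * q_fact_inv q (N - n)) =
    q_poch (-q) q N * (\<Sum>r\<le>N. (if r = 0 then 1 else 2) * (-1) ^ r * (fps_X ^ 3) ^ (r ^ 2) *
      (q_fact_inv q (N - r) * q_fact_inv q (N + r)))"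
proof -
  have q0: "fps_nth q 0 = 0" by (simp add: q_def)
  have pw: "q ^ (Suc n choose 2) = fps_X ^ (n ^ 2 + n)" for n
  proof -
    have "2 * (Suc n choose 2) = n ^ 2 + n"
      by (induction n) (simp_all add: numeral_2_eq_2)
    then show ?thesis by (simp add: q_def flip: power_mult)
  qed
  \<comment> \<open>The exponents of \<open>fps_X\<close> are \<open>r^2 + r\<close>,
    \<open>r^2\<close> and \<open>r^2 - r\<close>, with sum \<open>3 r^2\<close>: a Gauss sum in
    base \<open>fps_X ^ 3\<close>.\<close>
  have pw3: "q ^ (Suc r choose 2) * ((-1) ^ r * fps_X ^ (r ^ 2) * q ^ (r choose 2)) =
      (-1) ^ r * (fps_X ^ 3) ^ (r ^ 2)" for r
  proof -
    have "r + 2 * (r choose 2) = r ^ 2"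
      by (induction r) (simp_all add: numeral_2_eq_2)
    then have expo: "r ^ 2 + r + r ^ 2 + 2 * (r choose 2) = 3 * r ^ 2"
      by linarith
    have "q ^ (Suc r choose 2) * ((-1) ^ r * fps_X ^ (r ^ 2) * q ^ (r choose 2)) =
        (-1) ^ r * (fps_X ^ (r ^ 2 + r) * fps_X ^ (r ^ 2) * q ^ (r choose 2))"
      unfolding pw by (simp only: mult_ac)
    also have "\<dots> = (-1) ^ r * fps_X ^ (r ^ 2 + r + r ^ 2 + 2 * (r choose 2))"
      by (simp only: q_def power_mult power_add)
    finally show ?thesis
      by (simp only: expo power_mult)
  qed
  have "mod6_summand n * q_fact_inv q (N - n) = q_poch (-1) q n * q ^ (Suc n choose 2) *
      q_fact_inv q (N - n) * (q_fact_inv q n * inverse (q_poch (-fps_X) q n))" for n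
    unfolding pw mod6_summand_def fps_inverse_mult by (simp add: q_fact_inv_def q_def mult_ac)
  then have "(\<Sum>n\<le>N. mod6_summand n * q_fact_inv q (N - n)) = q_poch (-q) q N *
      (\<Sum>r\<le>N. (if r = 0 then 1 else 2) * q ^ (Suc r choose 2) *
        ((-1) ^ r * fps_X ^ (r ^ 2) * q ^ (r choose 2)) *
        (q_fact_inv q (N - r) * q_fact_inv q (N + r)))"
    using Bailey_lemma_neg_one[OF q0 Bailey_pair_square [where 'a='a, folded q_def]] by (simp only:)
  then show ?thesis
    by (simp only: mult.assoc[of _ "q ^ (Suc _ choose 2)"] pw3) (simp only: mult.assoc)
qed

text \<open>The numerator has the shape of Gauss's product in base \<open>fps_X ^ 3\<close>; the
  denominator is \<open>(q; q^2)_N (q; q)_N\<close> for \<open>q = fps_X ^ 2\<close>.\<close>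

definition mod6_product :: "nat \<Rightarrow> 'a::field fps" where
  "mod6_product N = q_poch (fps_X ^ 3) ((fps_X ^ 3) ^ 2) N ^ 2 *
     q_poch ((fps_X ^ 3) ^ 2) ((fps_X ^ 3) ^ 2) N *
     inverse (q_poch (fps_X ^ 2) ((fps_X ^ 2) ^ 2) N * q_poch (fps_X ^ 2) (fps_X ^ 2) N)"

lemma mod6_partial_sum_mod:
  "(\<Sum>n\<le>N. mod6_summand n) mod fps_X ^ N = (mod6_product N :: 'a::field fps) mod fps_X ^ N"
proof -
  define q :: "'a fps" where "q = fps_X ^ 2"
  have q0: "fps_nth q 0 = 0" and c0: "fps_nth (fps_X ^ 3 :: 'a fps) 0 = 0"
    by (simp_all add: q_def)
  let ?e = "q_fact_inv q N" and ?P = "q_poch q q N"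
  let ?o = "q_poch q (q ^ 2) N" and ?m = "q_poch (-q) q N"
  define S R f :: "'a fps" where "S = (\<Sum>n\<le>N. mod6_summand n)"
    and "R = (\<Sum>r\<le>N. (if r = 0 then 1 else 2) * (-1) ^ r * (fps_X ^ 3) ^ (r ^ 2))"
    and "f = q_poch (fps_X ^ 3) ((fps_X ^ 3) ^ 2) N ^ 2 *
      q_poch ((fps_X ^ 3) ^ 2) ((fps_X ^ 3) ^ 2) N"
  have eP: "?e * ?P = 1" by (rule q_fact_inv_mult[OF q0])
  have "fps_nth ?o 0 \<noteq> 0"
    by (induction N) (simp_all add: q_poch_Suc q0)
  then have inv: "inverse ?o * ?o = 1"
    by (rule inverse_mult_eq_1)
  have dvd: "fps_X ^ r dvd (if r = 0 then 1 else 2) * (-1) ^ r * (fps_X ^ 3 :: 'a fps) ^ (r ^ 2)" for r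
    unfolding power_mult [symmetric]
    by (intro dvd_mult le_imp_power_dvd) (simp add: power2_eq_square)
  have R: "R mod fps_X ^ N = f mod fps_X ^ N"
    unfolding R_def f_def using Gauss_sum_mod[OF c0] by simp
  have "(?e * S) mod fps_X ^ N = (\<Sum>n\<le>N. mod6_summand n * q_fact_inv q (N - n)) mod fps_X ^ N"
    unfolding S_def by (intro convolution_sum_mod[OF q0, symmetric] mod6_summand_dvd)
  also have "\<dots> = (?m * (?e ^ 2 * R)) mod fps_X ^ N"
    unfolding finite_mod6_identity[where 'a='a, folded q_def] R_def
    by (intro mod_mult_cong refl theta_sum_mod q0 dvd)
  \<comment> \<open>Multiplying by \<open>?P\<close> isolates \<open>S\<close>. The inserted unit
    \<open>inverse ?o * ?o\<close> provides the \<open>?o\<close> that cancels \<open>?m\<close> by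
    Euler's theorem and leaves \<open>inverse ?o\<close> in the product.\<close>
  finally have "(inverse ?o * ?o * ?P * (?e * S)) mod fps_X ^ N =
      (inverse ?o * ?o * ?P * (?m * (?e ^ 2 * R))) mod fps_X ^ N"
    by (rule mod_mult_cong [OF refl])
  also have "inverse ?o * ?o * ?P * (?e * S) = (inverse ?o * ?o) * (?e * ?P) * S"
    by (simp only: mult_ac)
  also have "inverse ?o * ?o * ?P * (?m * (?e ^ 2 * R)) =
      (?o * ?m) * (inverse ?o * (?e * ?P) * ?e * R)"
    by (simp only: power2_eq_square mult_ac)
  finally have "S mod fps_X ^ N = (?o * ?m * (inverse ?o * ?e * R)) mod fps_X ^ N"
    unfolding eP inv by simp
  also have "\<dots> = (1 * (inverse ?o * ?e * f)) mod fps_X ^ N"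
    by (intro mod_mult_cong refl R Euler_odd_distinct_mod q0)
  finally show ?thesis
    unfolding S_def f_def mod6_product_def fps_inverse_mult
    by (simp add: q_fact_inv_def q_def mult_ac)
qed

theorem theorem3:
  fixes q :: "'a::field_char_0 fps"
  defines "q \<equiv> fps_X"
  defines "a \<equiv> (\<lambda>n::nat. q_poch (-1) (q^2) n * q ^ (n^2 + n) *
                   inverse (q_poch (q^2) (q^2) n * q_poch (-q) (q^2) n))"
  defines "b \<equiv> (\<lambda>n::nat. (1 - q ^ (6*n - 3))^2 * (1 - q ^ (6*n)) *
                   inverse ((1 - q ^ (4*n - 2)) * (1 - q ^ (2*n))))"
  shows "summable a \<and> convergent_prod (\<lambda>n. b (Suc n)) \<and>
         (\<Sum>n. a n) = (\<Prod>n. b (Suc n))"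
proof -
  have a: "a = mod6_summand"
    by (rule ext) (simp add: a_def mod6_summand_def q_def)
  have b: "(\<Prod>i<n. b (Suc i)) = mod6_product n" for n
  proof (induction n)
    case (Suc n)
    \<comment> \<open>At index \<open>Suc n\<close> the truncated subtractions are exact: the
      exponents are \<open>6 n + 3\<close> and \<open>4 n + 2\<close>.\<close>
    have "q ^ (6 * Suc n - 3) = fps_X ^ 3 * ((fps_X ^ 3) ^ 2) ^ n"
      "q ^ (6 * Suc n) = (fps_X ^ 3) ^ 2 * ((fps_X ^ 3) ^ 2) ^ n"
      "q ^ (4 * Suc n - 2) = fps_X ^ 2 * ((fps_X ^ 2) ^ 2) ^ n"
      "q ^ (2 * Suc n) = fps_X ^ 2 * (fps_X ^ 2) ^ n"
      by (simp_all add: q_def flip: power_mult power_add)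
    then show ?case
      unfolding prod.lessThan_Suc Suc
      by (simp only: b_def mod6_product_def q_poch_Suc fps_inverse_mult power_mult_distrib mult_ac)
  qed (simp add: mod6_product_def)
  define S where "S N = (\<Sum>n\<le>N. a n)" for N
  define L where "L = Abs_fps (\<lambda>k. fps_nth (S (Suc k)) k)"
  have step: "fps_X ^ N dvd S (Suc N) - S N" for N
    using mod6_summand_dvd[of "Suc N", where 'a='a] unfolding S_def a
    by (simp add: dvd_mult_right)
  have close: "fps_X ^ N dvd S N - mod6_product N" for N
    unfolding S_def a mod_eq_dvd_iff [symmetric] by (rule mod6_partial_sum_mod)
  note lim = fps_common_limit[of S, OF step close, folded L_def]
  have sums: "a sums L"
    using lim(1) by (simp add: sums_def_le S_def [abs_def])
  \<comment> \<open>Convergence of an infinite product demands a nonzero limit; the constant term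
    shows this.\<close>
  have "fps_nth L 0 = 1"
    by (simp add: L_def S_def a mod6_summand_def)
  then have "L \<noteq> 0" by auto
  \<comment> \<open>Products over \<open>{..n}\<close> have \<open>Suc n\<close> factors, hence the
    shifted sequence.\<close>
  moreover have "(\<lambda>n. \<Prod>i\<le>n. b (Suc i)) \<longlonglongrightarrow> L"
    using LIMSEQ_Suc[OF lim(2)] by (simp only: b[symmetric] lessThan_Suc_atMost)
  ultimately have raw: "raw_has_prod (\<lambda>n. b (Suc n)) 0 L"
    by (simp add: raw_has_prod_def)
  then have prod: "(\<lambda>n. b (Suc n)) has_prod L"
    by (simp add: has_prod_def)
  show ?thesis
    using sums_summable[OF sums] sums_unique[OF sums] raw has_prod_unique[OF prod]
    by (auto simp: convergent_prod_def)
qed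

end
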